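(* Let $X,L\subset\mathbb{R}^d$ be finite nonempty sets and let $P=\{P_\sigma : \sigma\in\mathrm{Del}(L)\}$ be a family of finite nonempty sets with $P_\sigma\subset\mathrm{conv}(\sigma)$ for all $\sigma\in\mathrm{Del}(L)$. Then for every $i\in\mathbb{N}$, $$d_B\big(\mathrm{dgm}_i(\mathrm{Flood}(X,L)),\ \mathrm{dgm}_i(\mathrm{Flood}(X,L,P))\big)\le\max_{\sigma\in\mathrm{Del}(L)}d_H(P_\sigma,\mathrm{conv}(\sigma)).$$
   Context: $d(\cdot,\cdot)$ is the Euclidean metric on $\mathbb{R}^d$, $B_r(x)=\{y\in\mathbb{R}^d : d(x,y)\le r\}$, $X_r=\bigcup_{x\in X}B_r(x)$, and $\mathrm{conv}(\sigma)$ is the convex hull of $\sigma$. $\mathbb{N}$ includes $0$. $\mathrm{Del}(L)$ denotes the Delaunay complex (Delaunay triangulation) of $L$, viewed as an abstract simplicial complex on the vertex set $L$; if the Delaunay triangulation of $L$ is not unique, one is fixed and the same one is used throughout. Flood complex: for $r\ge0$, $\mathrm{Flood}_r(X,L)=\{\sigma\in\mathrm{Del}(L) : \mathrm{conv}(\sigma)\subset X_r\}$, and $\mathrm{Flood}(X,L)=\{\mathrm{Flood}_r(X,L)\}_{r\ge0}$. Discretized version: $\mathrm{Flood}_r(X,L,P)=\{\sigma\in\mathrm{Del}(L) : P_\tau\subset X_r \text{ for all nonempty } \tau\subset\sigma\}$, and $\mathrm{Flood}(X,L,P)=\{\mathrm{Flood}_r(X,L,P)\}_{r\ge0}$. Both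 are filtered simplicial complexes. $\mathrm{dgm}_i$ of a filtered simplicial complex denotes its $i$-th persistence diagram (homology $H_i$ with coefficients in a fixed field), i.e. the multiset of (birth, death) pairs, with death possibly $\infty$. The bottleneck distance is $d_B(D_1,D_2)=\inf_{\eta}\sup_{p\in D_1}\|p-\eta(p)\|_\infty$, the infimum being over all bijections $\eta:D_1\to D_2$, where every diagonal point $(b,b)$ is included in each diagram with infinite multiplicity. $d_H$ is the Hausdorff distance; since $P_\sigma\subset\mathrm{conv}(\sigma)$, $d_H(P_\sigma,\mathrm{conv}(\sigma))=\max_{q\in\mathrm{conv}(\sigma)}\min_{p\in P_\sigma}d(q,p)$. *)

theory Defs
  imports "HOL-Analysis.Analysis" "HOL-Library.Function_Algebras"
begin

section \<open>Delaunay triangulations\<close>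

definition abstract_complex :: "'a set set \<Rightarrow> bool" where
  "abstract_complex K \<longleftrightarrow>
     (\<forall>\<sigma>\<in>K. finite \<sigma> \<and> \<sigma> \<noteq> {} \<and> (\<forall>\<tau>. \<tau> \<subseteq> \<sigma> \<and> \<tau> \<noteq> {} \<longrightarrow> \<tau> \<in> K))"

text \<open>
  \<open>D\<close> is a Delaunay triangulation of the finite set \<open>L\<close>, given by the vertex sets of its
  simplices. Cospherical points may admit several such \<open>D\<close>. The points of \<open>L\<close> need not affinely
  span the space: a sphere meets the affine hull of \<open>L\<close> in a sphere of that affine space, and
  each such sphere arises in this way, so the empty-sphere condition is the one inside the hull.
\<close>

definition delaunay_triangulation :: "'a::euclidean_space set \<Rightarrow> 'a set set \<Rightarrow> bool" where
  "delaunay_triangulation L D \<longleftrightarrow>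
     abstract_complex D \<and> \<Union>D = L \<and>
     (\<forall>\<sigma>\<in>D. \<not> affine_dependent \<sigma>) \<and>
     triangulation ((\<lambda>\<sigma>. convex hull \<sigma>) ` D) \<and>
     (\<Union>\<sigma>\<in>D. convex hull \<sigma>) = convex hull L \<and>
     (\<forall>\<sigma>\<in>D. \<exists>c r. \<sigma> \<subseteq> sphere c r \<and> L \<inter> ball c r = {})"


section \<open>Flood complexes\<close>

definition thickening :: "'a::metric_space set \<Rightarrow> real \<Rightarrow> 'a set" where
  "thickening X r = (\<Union>x\<in>X. cball x r)"

definition flood :: "'a::euclidean_space set \<Rightarrow> 'a set set \<Rightarrow> real \<Rightarrow> 'a set set" where
  "flood X D r = {\<sigma>\<in>D. convex hull \<sigma> \<subseteq> thickening X r}"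

definition flood_discrete ::
  "'a::euclidean_space set \<Rightarrow> 'a set set \<Rightarrow> ('a set \<Rightarrow> 'a set) \<Rightarrow> real \<Rightarrow> 'a set set" where
  "flood_discrete X D P r = {\<sigma>\<in>D. \<forall>\<tau>. \<tau> \<subseteq> \<sigma> \<and> \<tau> \<noteq> {} \<longrightarrow> P \<tau> \<subseteq> thickening X r}"


section \<open>Simplicial homology with field coefficients\<close>

text \<open>
  An \<open>n\<close>-chain is a finitely supported function on the oriented \<open>n\<close>-simplices that changes sign
  when the orientation is reversed. An oriented simplex is given by an ordering of its vertices,
  and adjacent transpositions generate all reorderings.
\<close>

definition chains :: "nat \<Rightarrow> 'a set set \<Rightarrow> ('a list \<Rightarrow> 'k::field) set" where
  "chains n K = {c. finite {xs. c xs \<noteq> 0} \<and>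
     (\<forall>xs. c xs \<noteq> 0 \<longrightarrow> length xs = Suc n \<and> distinct xs \<and> set xs \<in> K) \<and>
     (\<forall>xs v w ys. c (xs @ v # w # ys) = - c (xs @ w # v # ys))}"

text \<open>
  In the usual boundary of the oriented simplex \<open>[v, x\<^sub>1, \<dots>, x\<^sub>n]\<close> the face \<open>[x\<^sub>1, \<dots>, x\<^sub>n]\<close> has
  sign \<open>+1\<close>, and every coface of \<open>[x\<^sub>1, \<dots>, x\<^sub>n]\<close> can be oriented in this form. Hence the
  coefficient of \<open>[x\<^sub>1, \<dots>, x\<^sub>n]\<close> in the boundary of \<open>c\<close> is the sum below. The homology is
  unreduced, so the boundary of a \<open>0\<close>-chain is zero.
\<close>

definition boundary :: "('a list \<Rightarrow> 'k::field) \<Rightarrow> 'a list \<Rightarrow> 'k" where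
  "boundary c xs = (if xs = [] then 0 else \<Sum>v | c (v # xs) \<noteq> 0. c (v # xs))"

lemma boundary_eq_sum:
  assumes "finite V" and "\<And>v. c (v # xs) \<noteq> 0 \<Longrightarrow> v \<in> V"
  shows "boundary c xs = (if xs = [] then 0 else \<Sum>v\<in>V. c (v # xs))"
proof -
  have "(\<Sum>v | c (v # xs) \<noteq> 0. c (v # xs)) = (\<Sum>v\<in>V. c (v # xs))"
    using assms by (intro sum.mono_neutral_left) auto
  then show ?thesis by (simp add: boundary_def)
qed

lemma chains_support:
  assumes "c \<in> chains n K"
  obtains V where "finite V" and "\<And>xs. c xs \<noteq> 0 \<Longrightarrow> set xs \<subseteq> V"
proof
  show "finite (\<Union>xs\<in>{xs. c xs \<noteq> 0}. set xs)"
    using assms unfolding chains_def by blast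
qed auto

lemma boundary_in_chains:
  assumes K: "abstract_complex K" and c: "c \<in> chains (Suc n) K"
  shows "boundary c \<in> chains n K"
proof -
  obtain V where V: "finite V" "\<And>xs. c xs \<noteq> 0 \<Longrightarrow> set xs \<subseteq> V"
    using chains_support[OF c] by blast
  have b: "boundary c xs = (if xs = [] then 0 else \<Sum>v\<in>V. c (v # xs))" for xs
    using V by (intro boundary_eq_sum) fastforce+
  have ex: "\<exists>v. c (v # xs) \<noteq> 0" if "boundary c xs \<noteq> 0" for xs
    using that by (auto simp: boundary_def split: if_splits intro: ccontr)
  have "{xs. boundary c xs \<noteq> 0} \<subseteq> tl ` {xs. c xs \<noteq> 0}"
    using ex by (force simp: image_iff)
  moreover have "finite {xs. c xs \<noteq> 0}"
    using c unfolding chains_def by blast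
  ultimately have fin: "finite {xs. boundary c xs \<noteq> 0}"
    using finite_surj by blast
  have supp: "length xs = Suc n \<and> distinct xs \<and> set xs \<in> K" if nz: "boundary c xs \<noteq> 0" for xs
  proof -
    obtain v where "c (v # xs) \<noteq> 0"
      using ex[OF nz] by blast
    then have "length (v # xs) = Suc (Suc n)" "distinct (v # xs)" "set (v # xs) \<in> K"
      using c unfolding chains_def by blast+
    moreover have "xs \<noteq> []"
      using nz by (auto simp: boundary_def)
    moreover have "\<tau> \<in> K" if "\<sigma> \<in> K" "\<tau> \<subseteq> \<sigma>" "\<tau> \<noteq> {}" for \<sigma> \<tau>
      using K that unfolding abstract_complex_def by blast
    then have "set xs \<in> K"
      using \<open>set (v # xs) \<in> K\<close> \<open>xs \<noteq> []\<close> by (metis set_empty set_subset_Cons)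
    ultimately show ?thesis
      by simp
  qed
  have swap: "c (zs @ v # w # ys) = - c (zs @ w # v # ys)" for zs v w ys
    using c unfolding chains_def by blast
  have alt: "boundary c (xs @ v # w # ys) = - boundary c (xs @ w # v # ys)" for xs v w ys
  proof -
    have "(\<Sum>u\<in>V. c (u # xs @ v # w # ys)) = (\<Sum>u\<in>V. - c (u # xs @ w # v # ys))"
      by (rule sum.cong[OF refl]) (rule swap[of "_ # xs", unfolded append_Cons])
    then show ?thesis by (simp add: b sum_negf)
  qed
  show ?thesis
    unfolding chains_def using fin supp alt by blast
qed

lemma boundary_boundary:
  assumes c: "c \<in> chains n K"
  shows "boundary (boundary c) = 0"
proof
  fix xs
  obtain V where V: "finite V" "\<And>xs. c xs \<noteq> 0 \<Longrightarrow> set xs \<subseteq> V"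
    using chains_support[OF c] by blast
  have b: "boundary c ys = (if ys = [] then 0 else \<Sum>v\<in>V. c (v # ys))" for ys
    using V by (intro boundary_eq_sum) fastforce+
  have "v \<in> V" if "boundary c (v # xs) \<noteq> 0" for v
  proof -
    have "\<exists>w. c (w # v # xs) \<noteq> 0"
      using that by (auto simp: boundary_def split: if_splits intro: ccontr)
    then show ?thesis using V(2) by fastforce
  qed
  then have bb: "boundary (boundary c) xs
      = (if xs = [] then 0 else \<Sum>v\<in>V. \<Sum>w\<in>V. c (w # v # xs))"
    using V(1) by (subst boundary_eq_sum[of V]) (auto simp: b)
  have swap: "c (zs @ v # w # ys) = - c (zs @ w # v # ys)" for zs v w ys
    using c unfolding chains_def by blast
  have anti: "c (w # v # xs) = - c (v # w # xs)" for v w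
    by (rule swap[of "[]", unfolded append_Nil])
  have "distinct ys" if "c ys \<noteq> 0" for ys
    using c that unfolding chains_def by blast
  then have diag: "c (v # v # xs) = 0" for v
    by fastforce
  have "(\<Sum>v\<in>V. \<Sum>w\<in>V. c (w # v # xs)) = 0"
    using V(1)
  proof (induction V rule: finite_induct)
    case (insert x F)
    have "(\<Sum>w\<in>F. c (w # x # xs)) = - (\<Sum>v\<in>F. c (x # v # xs))"
      unfolding sum_negf[symmetric] by (rule sum.cong[OF refl]) (rule anti)
    then show ?case
      using insert by (simp add: sum.distrib diag)
  qed simp
  then show "boundary (boundary c) xs = 0 xs"
    by (simp add: bb)
qed

definition cycles :: "nat \<Rightarrow> 'a set set \<Rightarrow> ('a list \<Rightarrow> 'k::field) set" where
  "cycles n K = {c \<in> chains n K. boundary c = 0}"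

definition boundaries :: "nat \<Rightarrow> 'a set set \<Rightarrow> ('a list \<Rightarrow> 'k::field) set" where
  "boundaries n K = boundary ` chains (Suc n) K"

definition chain_scale :: "'k::field \<Rightarrow> ('b \<Rightarrow> 'k) \<Rightarrow> 'b \<Rightarrow> 'k" where
  "chain_scale a c = (\<lambda>x. a * c x)"

global_interpretation chain_space: vector_space "chain_scale :: 'k::field \<Rightarrow> ('b \<Rightarrow> 'k) \<Rightarrow> 'b \<Rightarrow> 'k"
  defines chain_dim = chain_space.dim
  by unfold_locales (auto simp: chain_scale_def algebra_simps fun_eq_iff)


section \<open>Persistence diagrams\<close>

text \<open>
  For \<open>K \<subseteq> K'\<close> the image of \<open>H\<^sub>n(K) \<rightarrow> H\<^sub>n(K')\<close> is \<open>Z\<^sub>n(K) / (Z\<^sub>n(K) \<inter> B\<^sub>n(K'))\<close>; its dimension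
  is the rank of the map. The complexes in question are finite, so the dimensions are finite.
\<close>

definition homology_rank :: "'k::field itself \<Rightarrow> nat \<Rightarrow> 'a set set \<Rightarrow> 'a set set \<Rightarrow> nat" where
  "homology_rank _ n K K' =
     chain_dim (cycles n K :: ('a list \<Rightarrow> 'k) set) -
     chain_dim (cycles n K \<inter> boundaries n K' :: ('a list \<Rightarrow> 'k) set)"

text \<open>
  A filtered complex is indexed by the parameters \<open>r \<ge> 0\<close>; it counts as empty before \<open>0\<close>.
\<close>

definition persistent_betti ::
  "'k::field itself \<Rightarrow> nat \<Rightarrow> (real \<Rightarrow> 'a set set) \<Rightarrow> real \<Rightarrow> real \<Rightarrow> int" where
  "persistent_betti k n F s t = (if s < 0 then 0 else int (homology_rank k n (F s) (F t)))"

text \<open>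
  The alternating sum of persistent Betti numbers counts the classes that are born in
  \<open>(b - \<epsilon>, b + \<epsilon>]\<close> and die in \<open>(d - \<epsilon>, d + \<epsilon>]\<close>, or are still alive at \<open>1 / \<epsilon>\<close> if \<open>d = \<infinity>\<close>. For a
  filtration of a finite complex it is constant for small \<open>\<epsilon>\<close>. The diagram is the
  multiset of pairs \<open>(b, d)\<close> with \<open>b < d\<close>, represented by its multiplicity function.
\<close>

definition pair_count ::
  "'k::field itself \<Rightarrow> nat \<Rightarrow> (real \<Rightarrow> 'a set set) \<Rightarrow> real \<Rightarrow> ereal \<Rightarrow> real \<Rightarrow> int" where
  "pair_count k n F b d \<epsilon> =
     (if d = \<infinity> then
        persistent_betti k n F (b + \<epsilon>) (1 / \<epsilon>) - persistent_betti k n F (b - \<epsilon>) (1 / \<epsilon>)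
      else let d' = real_of_ereal d in
        (persistent_betti k n F (b + \<epsilon>) (d' - \<epsilon>) - persistent_betti k n F (b - \<epsilon>) (d' - \<epsilon>)) -
        (persistent_betti k n F (b + \<epsilon>) (d' + \<epsilon>) - persistent_betti k n F (b - \<epsilon>) (d' + \<epsilon>)))"

definition dgm ::
  "'k::field itself \<Rightarrow> nat \<Rightarrow> (real \<Rightarrow> 'a set set) \<Rightarrow> real \<times> ereal \<Rightarrow> nat" where
  "dgm k n F = (\<lambda>(b, d). if ereal b < d
     then (THE m. \<forall>\<^sub>F \<epsilon> in at_right 0. pair_count k n F b d \<epsilon> = int m) else 0)"


section \<open>Bottleneck and Hausdorff distance\<close>

text \<open>
  The second component numbers the copies of a point, so that maps between these sets are maps
  between multisets. Each diagonal point has infinitely many copies.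
\<close>

definition diagram_points :: "(real \<times> ereal \<Rightarrow> nat) \<Rightarrow> ((real \<times> ereal) \<times> nat) set" where
  "diagram_points m = {(p, j). j < m p} \<union> {((b, ereal b), j) | b j. True}"

text \<open>
  Two infinite deaths are at distance \<open>0\<close>, whereas \<open>\<infinity> - \<infinity> = \<infinity>\<close> in type \<open>ereal\<close>.
\<close>

definition point_dist :: "real \<times> ereal \<Rightarrow> real \<times> ereal \<Rightarrow> ereal" where
  "point_dist p q = max (ereal \<bar>fst p - fst q\<bar>)
     (if snd p = snd q then 0 else \<bar>snd p - snd q\<bar>)"

definition bottleneck_dist ::
  "(real \<times> ereal \<Rightarrow> nat) \<Rightarrow> (real \<times> ereal \<Rightarrow> nat) \<Rightarrow> ereal" where
  "bottleneck_dist m\<^sub>1 m\<^sub>2 =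
     (INF \<eta>\<in>{\<eta>. bij_betw \<eta> (diagram_points m\<^sub>1) (diagram_points m\<^sub>2)}.
        SUP p\<in>diagram_points m\<^sub>1. point_dist (fst p) (fst (\<eta> p)))"

definition hausdorff_dist :: "'a::metric_space set \<Rightarrow> 'a set \<Rightarrow> real" where
  "hausdorff_dist A B = max (SUP a\<in>A. infdist a B) (SUP b\<in>B. infdist b A)"

end

theory Submission
  imports Defs
begin

text \<open>
  Both filtrations are sublevel filtrations, on the finite set \<open>D\<close>, of functions at distance at
  most the right-hand side: \<open>\<sigma>\<close> enters at the largest distance to \<open>X\<close> of a point of its hull,
  respectively of one of the sets \<open>P \<tau>\<close> with \<open>\<tau> \<subseteq> \<sigma>\<close>. Interpolate linearly between
  the two functions. Close to any parameter \<open>x\<close> the interpolant at \<open>t\<close> orders the simplices at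
  least as finely as the one at \<open>x\<close>, so both are sublevel filtrations of one chain of
  complexes. The persistent Betti numbers of this chain determine multiplicities of index pairs,
  nonnegative by the modular law for dimensions, and the two diagrams arise by sending each
  index pair to its two parameter values. Pairing images of the same index pair moves no point by
  more than the distance of the functions. These local estimates are chained by the triangle
  inequality.
\<close>

section \<open>Ranks of inclusion maps\<close>

text \<open>Half of the modular law. A basis \<open>B\<close> of \<open>U \<inter> V\<close> extends
  to bases \<open>C\<close> of \<open>U\<close> and \<open>E\<close> of \<open>V\<close>, and
  \<open>C \<union> (E - B)\<close> stays independent inside \<open>W\<close>. The ambient function
  space can be infinite-dimensional, so finiteness enters through the finite set
  \<open>S\<close>.\<close>

lemma (in vector_space) dim_add_le:
  assumes U: "subspace U" "U \<subseteq> W" and V: "subspace V" "V \<subseteq> W"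
    and W: "W \<subseteq> span S" "finite S"
  shows "dim U + dim V \<le> dim W + dim (U \<inter> V)"
proof -
  obtain B where B: "B \<subseteq> U \<inter> V" "independent B" "U \<inter> V \<subseteq> span B" "card B = dim (U \<inter> V)"
    using basis_exists by blast
  obtain C where C: "B \<subseteq> C" "C \<subseteq> U" "independent C" "U \<subseteq> span C"
    using maximal_independent_subset_extend[of B U] B by blast
  obtain E where E: "B \<subseteq> E" "E \<subseteq> V" "independent E" "V \<subseteq> span E"
    using maximal_independent_subset_extend[of B V] B by blast
  obtain A where A: "A \<subseteq> W" "independent A" "W \<subseteq> span A" "card A = dim W"
    using basis_exists by blast
  have fin: "finite A" "finite C" "finite E"
    using independent_span_bound[OF W(2) A(2)] independent_span_bound[OF W(2) C(3)]
      independent_span_bound[OF W(2) E(3)] A(1) C(2) E(2) U(2) V(2) W(1) by auto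
  have indep: "independent (C \<union> T) \<and> C \<inter> T = {}" if "finite T" "T \<subseteq> E - B" for T
    using that
  proof (induction T rule: finite_induct)
    case empty
    then show ?case using C by simp
  next
    case (insert t T)
    \<comment> \<open>Otherwise \<open>t = x + y\<close> with \<open>x\<close> in \<open>U\<close>
      and \<open>y\<close> in \<open>V\<close>. Then \<open>x = t - y\<close> lies in
      \<open>U \<inter> V\<close>, hence in \<open>span B\<close>, and \<open>t\<close> depends on
      the other elements of \<open>E\<close>.\<close>
    have "t \<notin> span (C \<union> T)"
    proof
      assume "t \<in> span (C \<union> T)"
      then obtain x y where xy: "t = x + y" "x \<in> span C" "y \<in> span T"
        by (auto simp: span_Un)
      have "x \<in> U"
        using xy(2) span_minimal[OF C(2) U(1)] by blast
      have "T \<subseteq> V" "t \<in> V"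
        using insert.prems E(2) by auto
      then have "y \<in> V"
        using xy(3) span_minimal[OF _ V(1)] by blast
      with \<open>t \<in> V\<close> have "x \<in> V"
        using xy(1) subspace_diff[OF V(1), of t y] by simp
      then have "x \<in> span B"
        using \<open>x \<in> U\<close> B(3) by blast
      then have "t \<in> span (B \<union> T)"
        using xy by (auto simp: span_Un)
      moreover have "B \<union> T \<subseteq> E - {t}" "t \<in> E"
        using insert E by auto
      ultimately show False
        using E(3) span_mono[of "B \<union> T" "E - {t}"] by (auto simp: dependent_def)
    qed
    then show ?case
      using insert independent_insertI[of t "C \<union> T"] span_base[of t "C \<union> T"] by auto
  qed
  have "C \<union> (E - B) \<subseteq> span A"
    using A(3) C(2) E(2) U(2) V(2) by blast
  then have "card (C \<union> (E - B)) \<le> card A"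
    using independent_span_bound[OF fin(1)] indep[of "E - B"] fin(3) by blast
  moreover have "card (C \<union> (E - B)) = card C + card (E - B)"
    using indep[of "E - B"] fin by (intro card_Un_disjoint) auto
  moreover have "card E = card B + card (E - B)"
    using E(1) fin(3) by (metis card_Diff_subset card_mono finite_subset le_add_diff_inverse)
  moreover have "card C = dim U" "card E = dim V"
    using basis_card_eq_dim C E by auto
  ultimately show ?thesis
    using A B by linarith
qed

lemma (in vector_space) dim_mono_subspace:
  assumes "subspace U" "U \<subseteq> W" "W \<subseteq> span S" "finite S"
  shows "dim U \<le> dim W"
  using dim_add_le[of U W U S] assms by simp

section \<open>Linear structure of chains, cycles and boundaries\<close>

lemma chains_mono: "K \<subseteq> K' \<Longrightarrow> chains n K \<subseteq> chains n K'"
  by (auto simp: chains_def)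

lemma cycles_mono: "K \<subseteq> K' \<Longrightarrow> cycles n K \<subseteq> cycles n K'"
  unfolding cycles_def using chains_mono by blast

lemma boundaries_mono: "K \<subseteq> K' \<Longrightarrow> boundaries n K \<subseteq> boundaries n K'"
  unfolding boundaries_def by (intro image_mono chains_mono)

lemma subspace_chains: "chain_space.subspace (chains n K :: ('a list \<Rightarrow> 'k::field) set)"
proof (rule chain_space.subspaceI)
  show "0 \<in> (chains n K :: ('a list \<Rightarrow> 'k) set)"
    by (simp add: chains_def)
next
  fix c d :: "'a list \<Rightarrow> 'k" assume cd: "c \<in> chains n K" "d \<in> chains n K"
  have "finite {xs. (c + d) xs \<noteq> 0}"
    by (rule finite_subset[of _ "{xs. c xs \<noteq> 0} \<union> {xs. d xs \<noteq> 0}"]) (use cd in \<open>auto simp: chains_def\<close>)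
  moreover have "length xs = Suc n \<and> distinct xs \<and> set xs \<in> K" if "(c + d) xs \<noteq> 0" for xs
  proof -
    have "c xs \<noteq> 0 \<or> d xs \<noteq> 0"
      using that by auto
    then show ?thesis
      using cd unfolding chains_def by blast
  qed
  moreover have "(c + d) (xs @ v # w # ys) = - (c + d) (xs @ w # v # ys)" for xs v w ys
  proof -
    have "c (xs @ v # w # ys) = - c (xs @ w # v # ys)" "d (xs @ v # w # ys) = - d (xs @ w # v # ys)"
      using cd unfolding chains_def by blast+
    then show ?thesis
      by (simp only: plus_fun_apply minus_add_distrib)
  qed
  ultimately show "c + d \<in> chains n K"
    unfolding chains_def by blast
next
  fix a :: 'k and c :: "'a list \<Rightarrow> 'k" assume c: "c \<in> chains n K"
  have "finite {xs. chain_scale a c xs \<noteq> 0}"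
    by (rule finite_subset[of _ "{xs. c xs \<noteq> 0}"]) (use c in \<open>auto simp: chains_def chain_scale_def\<close>)
  moreover have "length xs = Suc n \<and> distinct xs \<and> set xs \<in> K" if "chain_scale a c xs \<noteq> 0" for xs
  proof -
    have "c xs \<noteq> 0"
      using that by (auto simp: chain_scale_def)
    then show ?thesis
      using c unfolding chains_def by blast
  qed
  moreover have "chain_scale a c (xs @ v # w # ys) = - chain_scale a c (xs @ w # v # ys)" for xs v w ys
  proof -
    have "c (xs @ v # w # ys) = - c (xs @ w # v # ys)"
      using c unfolding chains_def by blast
    then show ?thesis
      by (simp only: chain_scale_def mult_minus_right)
  qed
  ultimately show "chain_scale a c \<in> chains n K"
    unfolding chains_def by blast
qed

text \<open>The sum in \<open>boundary\<close> runs over a support that varies with the chain, so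
  all three sums are first extended to one finite vertex set.\<close>

lemma boundary_add:
  assumes "c \<in> chains n K" "d \<in> chains n K"
  shows "boundary (c + d) = boundary c + (boundary d :: 'a list \<Rightarrow> 'k::field)"
proof
  fix xs :: "'a list"
  obtain V where V: "finite V" "\<And>xs. c xs \<noteq> 0 \<Longrightarrow> set xs \<subseteq> V"
    using chains_support[OF assms(1)] by blast
  obtain W where W: "finite W" "\<And>xs. d xs \<noteq> 0 \<Longrightarrow> set xs \<subseteq> W"
    using chains_support[OF assms(2)] by blast
  have vw: "v \<in> V \<union> W" if "c (v # xs) \<noteq> 0 \<or> d (v # xs) \<noteq> 0" for v
    using that V(2)[of "v # xs"] W(2)[of "v # xs"] by auto
  have "v \<in> V \<union> W" if "(c + d) (v # xs) \<noteq> 0" for v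
    using that by (intro vw) auto
  then have "boundary (c + d) xs = (if xs = [] then 0 else \<Sum>v\<in>V \<union> W. (c + d) (v # xs))"
    using V(1) W(1) by (intro boundary_eq_sum) auto
  moreover have "boundary c xs = (if xs = [] then 0 else \<Sum>v\<in>V \<union> W. c (v # xs))"
    using V(1) W(1) vw by (intro boundary_eq_sum) auto
  moreover have "boundary d xs = (if xs = [] then 0 else \<Sum>v\<in>V \<union> W. d (v # xs))"
    using V(1) W(1) vw by (intro boundary_eq_sum) auto
  ultimately show "boundary (c + d) xs = (boundary c + boundary d) xs"
    by (simp add: sum.distrib)
qed

text \<open>A nonzero factor leaves the support, and so the range of summation, unchanged; a zero
  factor makes both sides zero.\<close>

lemma boundary_scale: "boundary (chain_scale a c) = chain_scale a (boundary c)"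
  by (cases "a = 0") (auto simp: fun_eq_iff boundary_def chain_scale_def sum_distrib_left)

lemma subspace_cycles: "chain_space.subspace (cycles n K :: ('a list \<Rightarrow> 'k::field) set)"
proof (rule chain_space.subspaceI)
  show "0 \<in> (cycles n K :: ('a list \<Rightarrow> 'k) set)"
    using chain_space.subspace_0[OF subspace_chains] by (auto simp: cycles_def boundary_def)
qed (auto simp: cycles_def boundary_scale boundary_add chain_space.subspace_add[OF subspace_chains]
    chain_space.subspace_scale[OF subspace_chains])

lemma subspace_boundaries: "chain_space.subspace (boundaries n K :: ('a list \<Rightarrow> 'k::field) set)"
proof (rule chain_space.subspaceI)
  have "boundary (0 :: 'a list \<Rightarrow> 'k) = 0"
    by (auto simp: boundary_def)
  then show "0 \<in> (boundaries n K :: ('a list \<Rightarrow> 'k) set)"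
    using chain_space.subspace_0[OF subspace_chains] unfolding boundaries_def by (metis image_eqI)
next
  fix c d :: "'a list \<Rightarrow> 'k" assume "c \<in> boundaries n K" "d \<in> boundaries n K"
  then show "c + d \<in> boundaries n K"
    unfolding boundaries_def
    by (auto simp: boundary_add[symmetric] intro!: imageI chain_space.subspace_add[OF subspace_chains])
next
  fix a :: 'k and c :: "'a list \<Rightarrow> 'k" assume "c \<in> boundaries n K"
  then show "chain_scale a c \<in> boundaries n K"
    unfolding boundaries_def
    by (auto simp: boundary_scale[symmetric] intro!: imageI chain_space.subspace_scale[OF subspace_chains])
qed

text \<open>Chains are combinations of indicator functions of vertex lists. Those functions need not
  alternate, so the spanning set may lie outside the chain space; it only has to bound
  dimensions.\<close>

lemma chains_finite_span:
  assumes "finite K"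
  obtains S :: "('a list \<Rightarrow> 'k::field) set" where "finite S" "chains n K \<subseteq> chain_space.span S"
proof -
  \<comment> \<open>An infinite member of \<open>K\<close> is never the set of a list, so only
    finite members contribute vertices.\<close>
  define A where "A = {xs. set xs \<subseteq> \<Union>{\<sigma>\<in>K. finite \<sigma>} \<and> length xs = Suc n}"
  define e where "e = (\<lambda>xs ys :: 'a list. if ys = xs then 1 else 0 :: 'k)"
  have A: "finite A"
    unfolding A_def using assms by (intro finite_lists_length_eq) auto
  have "c \<in> chain_space.span (e ` A)" if c: "c \<in> chains n K" for c
  proof -
    have sum_apply: "(\<Sum>xs\<in>F. g xs) ys = (\<Sum>xs\<in>F. g xs ys)"
      for F and g :: "'a list \<Rightarrow> 'a list \<Rightarrow> 'k" and ys
      by (induction F rule: infinite_finite_induct) auto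
    have "c ys = 0" if "ys \<notin> A" for ys
    proof (rule ccontr)
      assume "c ys \<noteq> 0"
      then have "set ys \<in> K" "length ys = Suc n"
        using c by (auto simp: chains_def)
      then show False
        using that by (auto simp: A_def)
    qed
    then have "c = (\<Sum>xs\<in>A. chain_scale (c xs) (e xs))"
      using A by (intro ext) (simp add: sum_apply, simp add: chain_scale_def e_def if_distrib cong: if_cong)
    also have "\<dots> \<in> chain_space.span (e ` A)"
      by (intro chain_space.span_sum chain_space.span_scale chain_space.span_base imageI)
    finally show ?thesis .
  qed
  then show thesis
    using A that[of "e ` A"] by blast
qed

section \<open>Inequalities between ranks\<close>

text \<open>The subtraction of natural numbers in \<open>homology_rank\<close> does not truncate,
  since the second space is a subspace of the first and both are finite-dimensional.\<close>

lemma homology_rank_eq: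
  assumes "finite K"
  shows "int (homology_rank TYPE('k::field) n K K') =
    int (chain_dim (cycles n K :: ('a list \<Rightarrow> 'k) set))
    - int (chain_dim (cycles n K \<inter> boundaries n K' :: ('a list \<Rightarrow> 'k) set))"
proof -
  obtain S :: "('a list \<Rightarrow> 'k) set" where S: "finite S" "chains n K \<subseteq> chain_space.span S"
    using chains_finite_span[OF assms] by blast
  have "chain_dim (cycles n K \<inter> boundaries n K' :: ('a list \<Rightarrow> 'k) set)
      \<le> chain_dim (cycles n K :: ('a list \<Rightarrow> 'k) set)"
    using S
    by (intro chain_space.dim_mono_subspace[of _ _ S] chain_space.subspace_inter
        subspace_cycles subspace_boundaries) (auto simp: cycles_def)
  then show ?thesis
    by (simp add: homology_rank_def)
qed

lemma homology_rank_empty: "homology_rank TYPE('k::field) n {} K = 0"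
proof -
  have "cycles n {} \<subseteq> {0 :: 'a list \<Rightarrow> 'k}"
    by (auto simp: cycles_def chains_def)
  then have "chain_dim (cycles n {} :: ('a list \<Rightarrow> 'k) set) \<le> card ({} :: ('a list \<Rightarrow> 'k) set)"
    by (intro chain_space.dim_le_card) auto
  then show ?thesis
    by (simp add: homology_rank_def)
qed

text \<open>The quotient of \<open>?Z\<^sub>1\<close> by \<open>?Z\<^sub>1 \<inter> ?B\<close>
  embeds in that of \<open>?Z\<^sub>2\<close> by \<open>?Z\<^sub>2 \<inter> ?B\<close>. In
  dimensions this is \<open>dim_add_le\<close> for \<open>?Z\<^sub>1\<close> and
  \<open>?Z\<^sub>2 \<inter> ?B\<close> inside \<open>?Z\<^sub>2\<close>.\<close>

lemma homology_rank_mono: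
  assumes "finite K\<^sub>2" "K\<^sub>1 \<subseteq> K\<^sub>2"
  shows "homology_rank TYPE('k::field) n K\<^sub>1 K \<le> homology_rank TYPE('k) n K\<^sub>2 K"
proof -
  let ?Z\<^sub>1 = "cycles n K\<^sub>1 :: ('a list \<Rightarrow> 'k) set" and ?Z\<^sub>2 = "cycles n K\<^sub>2 :: ('a list \<Rightarrow> 'k) set"
  let ?B = "boundaries n K :: ('a list \<Rightarrow> 'k) set"
  obtain S :: "('a list \<Rightarrow> 'k) set" where S: "finite S" "chains n K\<^sub>2 \<subseteq> chain_space.span S"
    using chains_finite_span[OF assms(1)] by blast
  have "chain_dim ?Z\<^sub>1 + chain_dim (?Z\<^sub>2 \<inter> ?B) \<le> chain_dim ?Z\<^sub>2 + chain_dim (?Z\<^sub>1 \<inter> (?Z\<^sub>2 \<inter> ?B))"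
    using S cycles_mono[OF assms(2)]
    by (intro chain_space.dim_add_le[of _ _ _ S] chain_space.subspace_inter
        subspace_cycles subspace_boundaries) (auto simp: cycles_def)
  also have "?Z\<^sub>1 \<inter> (?Z\<^sub>2 \<inter> ?B) = ?Z\<^sub>1 \<inter> ?B"
    using cycles_mono[OF assms(2)] by blast
  finally show ?thesis
    using homology_rank_eq[OF assms(1), of n K, where 'k = 'k]
      homology_rank_eq[OF finite_subset[OF assms(2,1)], of n K, where 'k = 'k] by linarith
qed

text \<open>The dimensions of the cycle spaces cancel. What remains is \<open>dim_add_le\<close> for
  \<open>?Z\<^sub>1 \<inter> ?B\<^sub>4\<close> and \<open>?Z\<^sub>2 \<inter> ?B\<^sub>3\<close>,
  which meet in \<open>?Z\<^sub>1 \<inter> ?B\<^sub>3\<close>. This makes the multiplicities of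
  finite index pairs nonnegative.\<close>

lemma homology_rank_supermodular:
  assumes "finite K\<^sub>2" "K\<^sub>1 \<subseteq> K\<^sub>2" "K\<^sub>3 \<subseteq> K\<^sub>4"
  shows "homology_rank TYPE('k::field) n K\<^sub>1 K\<^sub>3 + homology_rank TYPE('k) n K\<^sub>2 K\<^sub>4
    \<le> homology_rank TYPE('k) n K\<^sub>2 K\<^sub>3 + homology_rank TYPE('k) n K\<^sub>1 K\<^sub>4"
proof -
  let ?Z\<^sub>1 = "cycles n K\<^sub>1 :: ('a list \<Rightarrow> 'k) set" and ?Z\<^sub>2 = "cycles n K\<^sub>2 :: ('a list \<Rightarrow> 'k) set"
  let ?B\<^sub>3 = "boundaries n K\<^sub>3 :: ('a list \<Rightarrow> 'k) set" and ?B\<^sub>4 = "boundaries n K\<^sub>4 :: ('a list \<Rightarrow> 'k) set"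
  obtain S :: "('a list \<Rightarrow> 'k) set" where S: "finite S" "chains n K\<^sub>2 \<subseteq> chain_space.span S"
    using chains_finite_span[OF assms(1)] by blast
  have sub: "?Z\<^sub>1 \<subseteq> ?Z\<^sub>2" "?B\<^sub>3 \<subseteq> ?B\<^sub>4"
    using cycles_mono boundaries_mono assms by blast+
  have "chain_dim (?Z\<^sub>1 \<inter> ?B\<^sub>4) + chain_dim (?Z\<^sub>2 \<inter> ?B\<^sub>3)
      \<le> chain_dim (?Z\<^sub>2 \<inter> ?B\<^sub>4) + chain_dim ((?Z\<^sub>1 \<inter> ?B\<^sub>4) \<inter> (?Z\<^sub>2 \<inter> ?B\<^sub>3))"
    using S sub
    by (intro chain_space.dim_add_le[of _ _ _ S] chain_space.subspace_inter
        subspace_cycles subspace_boundaries) (auto simp: cycles_def)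
  also have "(?Z\<^sub>1 \<inter> ?B\<^sub>4) \<inter> (?Z\<^sub>2 \<inter> ?B\<^sub>3) = ?Z\<^sub>1 \<inter> ?B\<^sub>3"
    using sub by blast
  finally show ?thesis
    using homology_rank_eq[OF assms(1), of n K\<^sub>3, where 'k = 'k]
      homology_rank_eq[OF assms(1), of n K\<^sub>4, where 'k = 'k]
      homology_rank_eq[OF finite_subset[OF assms(2,1)], of n K\<^sub>3, where 'k = 'k]
      homology_rank_eq[OF finite_subset[OF assms(2,1)], of n K\<^sub>4, where 'k = 'k] by linarith
qed

section \<open>Matchings of diagrams\<close>

text \<open>A single bijection has to realize the bound, whereas \<open>bottleneck_dist\<close> is
  an infimum; bounds therefore add under composition without approximation.\<close>

definition matched ::
  "real \<Rightarrow> (real \<times> ereal \<Rightarrow> nat) \<Rightarrow> (real \<times> ereal \<Rightarrow> nat) \<Rightarrow> bool" where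
  "matched e m\<^sub>1 m\<^sub>2 \<longleftrightarrow> (\<exists>\<eta>. bij_betw \<eta> (diagram_points m\<^sub>1) (diagram_points m\<^sub>2) \<and>
     (\<forall>p\<in>diagram_points m\<^sub>1. point_dist (fst p) (fst (\<eta> p)) \<le> ereal e))"

lemma bottleneck_dist_le:
  assumes "matched e m\<^sub>1 m\<^sub>2"
  shows "bottleneck_dist m\<^sub>1 m\<^sub>2 \<le> ereal e"
proof -
  obtain \<eta> where \<eta>: "bij_betw \<eta> (diagram_points m\<^sub>1) (diagram_points m\<^sub>2)"
    "\<forall>p\<in>diagram_points m\<^sub>1. point_dist (fst p) (fst (\<eta> p)) \<le> ereal e"
    using assms by (auto simp: matched_def)
  then show ?thesis
    unfolding bottleneck_dist_def by (intro INF_lower2[of \<eta>] SUP_least) auto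
qed

text \<open>Equal second components include two infinite deaths. The condition
  \<open>0 \<le> e\<close> implicit in their distance 0 already follows from the first
  coordinates.\<close>

lemma point_dist_le_iff:
  "point_dist p q \<le> ereal e \<longleftrightarrow> \<bar>fst p - fst q\<bar> \<le> e \<and>
     (snd p = snd q \<or> (\<exists>x y. snd p = ereal x \<and> snd q = ereal y \<and> \<bar>x - y\<bar> \<le> e))"
proof -
  have "(if snd p = snd q then 0 else \<bar>snd p - snd q\<bar>) \<le> ereal e \<longleftrightarrow>
      (snd p = snd q \<and> 0 \<le> e \<or> (\<exists>x y. snd p = ereal x \<and> snd q = ereal y \<and> \<bar>x - y\<bar> \<le> e))"
    by (cases "snd p"; cases "snd q") (auto simp: zero_ereal_def)
  then show ?thesis
    unfolding point_dist_def max.bounded_iff by auto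
qed

lemma point_dist_sym: "point_dist p q \<le> ereal e \<Longrightarrow> point_dist q p \<le> ereal e"
  unfolding point_dist_le_iff by (auto simp: abs_minus_commute)

lemma point_dist_trans:
  assumes "point_dist p q \<le> ereal a" "point_dist q s \<le> ereal b"
  shows "point_dist p s \<le> ereal (a + b)"
  using assms unfolding point_dist_le_iff by auto

lemma matched_trans:
  assumes "matched a m\<^sub>1 m\<^sub>2" "matched b m\<^sub>2 m\<^sub>3"
  shows "matched (a + b) m\<^sub>1 m\<^sub>3"
proof -
  obtain \<eta> where \<eta>: "bij_betw \<eta> (diagram_points m\<^sub>1) (diagram_points m\<^sub>2)"
    "\<forall>p\<in>diagram_points m\<^sub>1. point_dist (fst p) (fst (\<eta> p)) \<le> ereal a"
    using assms by (auto simp: matched_def)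
  obtain \<theta> where \<theta>: "bij_betw \<theta> (diagram_points m\<^sub>2) (diagram_points m\<^sub>3)"
    "\<forall>p\<in>diagram_points m\<^sub>2. point_dist (fst p) (fst (\<theta> p)) \<le> ereal b"
    using assms by (auto simp: matched_def)
  have "point_dist (fst p) (fst ((\<theta> \<circ> \<eta>) p)) \<le> ereal (a + b)" if "p \<in> diagram_points m\<^sub>1" for p
    using that \<eta> \<theta> bij_betwE[OF \<eta>(1)] by (auto intro: point_dist_trans)
  then show ?thesis
    unfolding matched_def using bij_betw_trans[OF \<eta>(1) \<theta>(1)] by blast
qed

lemma matched_sym:
  assumes "matched a m\<^sub>1 m\<^sub>2"
  shows "matched a m\<^sub>2 m\<^sub>1"
proof -
  obtain \<eta> where \<eta>: "bij_betw \<eta> (diagram_points m\<^sub>1) (diagram_points m\<^sub>2)"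
    "\<forall>p\<in>diagram_points m\<^sub>1. point_dist (fst p) (fst (\<eta> p)) \<le> ereal a"
    using assms by (auto simp: matched_def)
  let ?\<theta> = "inv_into (diagram_points m\<^sub>1) \<eta>"
  have "point_dist (fst p) (fst (?\<theta> p)) \<le> ereal a" if "p \<in> diagram_points m\<^sub>2" for p
  proof -
    have "?\<theta> p \<in> diagram_points m\<^sub>1" "\<eta> (?\<theta> p) = p"
      using that bij_betw_inv_into[OF \<eta>(1)] bij_betw_inv_into_right[OF \<eta>(1)] bij_betwE by blast+
    then show ?thesis
      using \<eta>(2) point_dist_sym by metis
  qed
  then show ?thesis
    unfolding matched_def using bij_betw_inv_into[OF \<eta>(1)] by blast
qed

section \<open>Diagrams as images of an index set\<close>

text \<open>Numberings of the fibres of \<open>l\<close> glue to one bijection that keeps the label.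
  The set \<open>S\<close> will be a set of numbered points as in
  \<open>diagram_points\<close>.\<close>

lemma bij_betw_fibrewise:
  assumes g: "\<And>p. bij_betw (g p) {a\<in>A. l a = p} {j. (p, j) \<in> S}"
  shows "bij_betw (\<lambda>a. (l a, g (l a) a)) A S"
proof (rule bij_betw_imageI)
  show "inj_on (\<lambda>a. (l a, g (l a) a)) A"
    using g unfolding inj_on_def bij_betw_def by auto
  have "(p, j) \<in> (\<lambda>a. (l a, g (l a) a)) ` A \<longleftrightarrow> (p, j) \<in> S" for p j
    using bij_betw_imp_surj_on[OF g[of p]] by (auto simp: image_def set_eq_iff)
  then show "(\<lambda>a. (l a, g (l a) a)) ` A = S"
    by auto
qed

definition push_diagram :: "'q set \<Rightarrow> ('q \<Rightarrow> real \<times> ereal) \<Rightarrow> real \<times> ereal \<Rightarrow> nat" where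
  "push_diagram Q u = (\<lambda>(b, d). if ereal b < d then card {q\<in>Q. u q = (b, d)} else 0)"

text \<open>
  The points of \<open>Q\<close> that \<open>u\<close> sends to the diagonal are absorbed by the infinitely many copies of
  their images.
\<close>

lemma push_diagram_enumeration:
  fixes u :: "'q \<Rightarrow> real \<times> ereal"
  assumes Q: "finite Q" "\<And>q. q \<in> Q \<Longrightarrow> ereal (fst (u q)) \<le> snd (u q)"
  obtains h where "bij_betw h (Q <+> (UNIV :: (real \<times> nat) set)) (diagram_points (push_diagram Q u))"
    and "\<And>a. fst (h a) = case_sum u (\<lambda>(b, j). (b, ereal b)) a"
proof -
  \<comment> \<open>The right summand lists the diagonal: \<open>(b, j)\<close> stands for copy
    \<open>j\<close> of the point at \<open>b\<close>.\<close>
  let ?l = "case_sum u (\<lambda>(b, j :: nat). (b, ereal b))"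
  let ?A = "Q <+> (UNIV :: (real \<times> nat) set)"
  let ?D = "diagram_points (push_diagram Q u)"
  have "\<exists>g. bij_betw g {a\<in>?A. ?l a = p} {j. (p, j) \<in> ?D}" for p
  proof -
    obtain b d where p: "p = (b, d)"
      by (cases p)
    consider "ereal b < d" | "d = ereal b" | "d < ereal b"
      using linorder_cases by blast
    then show ?thesis
    proof cases
      case 1
      then have "{a\<in>?A. ?l a = p} = Inl ` {q\<in>Q. u q = p}"
        by (auto simp: p)
      moreover have "{j. (p, j) \<in> ?D} = {..<card {q\<in>Q. u q = p}}"
        using 1 by (auto simp: p diagram_points_def push_diagram_def)
      ultimately show ?thesis
        using Q(1) by (intro finite_same_card_bij) (auto simp: card_image)
    next
      case 2
      have eq: "{a\<in>?A. ?l a = p} = Inl ` {q\<in>Q. u q = p} \<union> (\<lambda>j. Inr (b, j)) ` UNIV"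
        by (auto simp: p 2)
      have "infinite (range (\<lambda>j. Inr (b, j) :: 'q + real \<times> nat))"
        by (intro range_inj_infinite) (auto simp: inj_def)
      then have "infinite {a\<in>?A. ?l a = p}"
        unfolding eq by simp
      moreover have "countable {a\<in>?A. ?l a = p}"
        unfolding eq using Q(1) by (auto intro: countable_finite)
      moreover have "{j. (p, j) \<in> ?D} = UNIV"
        by (auto simp: p 2 diagram_points_def)
      ultimately show ?thesis
        using to_nat_on_infinite by (intro exI[of _ "to_nat_on {a\<in>?A. ?l a = p}"]) (simp only:)
    next
      case 3
      then have "{a\<in>?A. ?l a = p} = {}"
        by (auto simp: p dest!: Q(2))
      moreover have "{j. (p, j) \<in> ?D} = {}"
        using 3 by (auto simp: p diagram_points_def push_diagram_def)
      ultimately have "bij_betw undefined {a\<in>?A. ?l a = p} {j. (p, j) \<in> ?D}"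
        by (simp only: bij_betw_def inj_on_empty image_empty simp_thms)
      then show ?thesis
        by blast
    qed
  qed
  then have "\<exists>g. \<forall>p. bij_betw (g p) {a\<in>?A. ?l a = p} {j. (p, j) \<in> ?D}"
    by (intro choice allI)
  then obtain g where g: "\<And>p. bij_betw (g p) {a\<in>?A. ?l a = p} {j. (p, j) \<in> ?D}"
    by blast
  then have "bij_betw (\<lambda>a. (?l a, g (?l a) a)) ?A ?D"
    by (rule bij_betw_fibrewise)
  then show thesis
    using that[of "\<lambda>a. (?l a, g (?l a) a)"] by simp
qed

text \<open>One index set enumerates both diagrams. Composing one enumeration with the inverse of
  the other pairs \<open>u q\<close> with \<open>v q\<close>, even if one of them is diagonal, and
  every extra diagonal copy with a copy of the same point.\<close>

lemma matched_push_diagram: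
  assumes "finite Q" "0 \<le> e"
    and u: "\<And>q. q \<in> Q \<Longrightarrow> ereal (fst (u q)) \<le> snd (u q)"
    and v: "\<And>q. q \<in> Q \<Longrightarrow> ereal (fst (v q)) \<le> snd (v q)"
    and uv: "\<And>q. q \<in> Q \<Longrightarrow> point_dist (u q) (v q) \<le> ereal e"
  shows "matched e (push_diagram Q u) (push_diagram Q v)"
proof -
  let ?A = "Q <+> (UNIV :: (real \<times> nat) set)"
  obtain g where g: "bij_betw g ?A (diagram_points (push_diagram Q u))"
    "\<And>a. fst (g a) = case_sum u (\<lambda>(b, j). (b, ereal b)) a"
    using push_diagram_enumeration[of Q u] assms by blast
  obtain h where h: "bij_betw h ?A (diagram_points (push_diagram Q v))"
    "\<And>a. fst (h a) = case_sum v (\<lambda>(b, j). (b, ereal b)) a"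
    using push_diagram_enumeration[of Q v] assms by blast
  let ?\<eta> = "h \<circ> inv_into ?A g"
  have "bij_betw ?\<eta> (diagram_points (push_diagram Q u)) (diagram_points (push_diagram Q v))"
    using bij_betw_trans[OF bij_betw_inv_into[OF g(1)] h(1)] .
  moreover have "point_dist (fst p) (fst (?\<eta> p)) \<le> ereal e"
    if p: "p \<in> diagram_points (push_diagram Q u)" for p
  proof -
    obtain a where a: "a \<in> ?A" "p = g a"
      using bij_betw_imp_surj_on[OF g(1)] p by blast
    then have "?\<eta> p = h a"
      using bij_betw_inv_into_left[OF g(1)] by simp
    moreover have "point_dist (fst (g a)) (fst (h a)) \<le> ereal e"
    proof (cases a)
      case (Inl q)
      then show ?thesis
        using a(1) uv by (auto simp: g(2) h(2))
    next
      case (Inr x)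
      then show ?thesis
        using \<open>0 \<le> e\<close> by (cases x) (simp add: g(2) h(2) point_dist_le_iff)
    qed
    ultimately show ?thesis
      using a(2) by simp
  qed
  ultimately show ?thesis
    unfolding matched_def by blast
qed

section \<open>Diagrams of finite filtrations\<close>

text \<open>Used to turn threshold conditions on indices into initial segments, with the number of
  indices as the cut.\<close>

lemma down_closed_eq_lessThan_card:
  fixes S :: "nat set"
  assumes "finite S" "\<And>i j. i \<le> j \<Longrightarrow> j \<in> S \<Longrightarrow> i \<in> S"
  shows "S = {..<card S}"
proof (cases "S = {}")
  case False
  then have "S = {..Max S}"
    using assms Max_in by (auto intro: Max_ge)
  then have "S = {..<Suc (Max S)}"
    by (simp only: lessThan_Suc_atMost)
  then show ?thesis
    by (metis card_lessThan)
qed simp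

text \<open>For small \<epsilon> the shifts in \<open>pair_count\<close> amount to weak and strict
  comparisons with a critical value \<open>y\<close>, and \<open>1 / \<epsilon>\<close> lies beyond
  it.\<close>

lemma eventually_at_right_compare:
  fixes x y :: real
  shows "\<forall>\<^sub>F \<epsilon> in at_right 0. (y \<le> x + \<epsilon> \<longleftrightarrow> y \<le> x) \<and> (y \<le> x - \<epsilon> \<longleftrightarrow> y < x) \<and> y \<le> 1 / \<epsilon>"
proof -
  \<comment> \<open>The first entry keeps \<epsilon> below the gap between \<open>x\<close> and
    \<open>y\<close>, if there is one; the second forces
    \<open>y \<le> 1 / \<epsilon>\<close>.\<close>
  define \<delta> where "\<delta> = min (if y = x then 1 else \<bar>y - x\<bar>) (1 / (\<bar>y\<bar> + 1))"
  have "0 < \<delta>"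
    by (auto simp: \<delta>_def)
  moreover have *: "(y \<le> x + \<epsilon> \<longleftrightarrow> y \<le> x) \<and> (y \<le> x - \<epsilon> \<longleftrightarrow> y < x) \<and> y \<le> 1 / \<epsilon>"
    if "\<epsilon> \<in> {0<..<\<delta>}" for \<epsilon>
  proof -
    have \<epsilon>: "0 < \<epsilon>" "\<epsilon> < 1 / (\<bar>y\<bar> + 1)" "y \<noteq> x \<Longrightarrow> \<epsilon> < \<bar>y - x\<bar>"
      using that by (auto simp: \<delta>_def)
    have "\<epsilon> * \<bar>y\<bar> + \<epsilon> < 1"
      using \<epsilon>(2) by (simp add: field_simps)
    moreover have "y * \<epsilon> \<le> \<epsilon> * \<bar>y\<bar>"
      using \<epsilon>(1) by (simp add: mult.commute)
    ultimately have "y * \<epsilon> \<le> 1"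
      using \<epsilon>(1) by linarith
    then have "y \<le> 1 / \<epsilon>"
      using \<epsilon>(1) by (simp add: pos_le_divide_eq)
    then show ?thesis
      using \<epsilon>(1,3) by (cases "y = x") (auto simp: abs_if split: if_splits)
  qed
  ultimately show ?thesis
    by (intro eventually_mono[OF eventually_at_right_real *])
qed

section \<open>Index pairs and their multiplicities\<close>

text \<open>Steps are numbered from 0: step \<open>i\<close> leads from \<open>K i\<close> to
  \<open>K (Suc i)\<close>, so \<open>K i\<close> is the state before step \<open>i\<close>.\<close>

locale finite_filtration =
  fixes K :: "nat \<Rightarrow> 'a set set" and N :: nat
  assumes K_mono: "i \<le> j \<Longrightarrow> K i \<subseteq> K j" and finite_K: "finite (K i)" and K_0: "K 0 = {}"
begin

text \<open>Step \<open>N\<close> plays the role of infinity: every class is dead in the fictitious \<open>K (N + 1)\<close>.\<close>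

definition rank :: "'k::field itself \<Rightarrow> nat \<Rightarrow> nat \<Rightarrow> nat \<Rightarrow> int" where
  "rank k n i j = (if j \<le> N then int (homology_rank k n (K i) (K j)) else 0)"

text \<open>The usual inclusion-exclusion formula for classes born at step \<open>i\<close> and
  dying at step \<open>j\<close>, with indices shifted by one because step \<open>i\<close> produces
  \<open>K (Suc i)\<close>.\<close>

definition multiplicity :: "'k::field itself \<Rightarrow> nat \<Rightarrow> nat \<Rightarrow> nat \<Rightarrow> int" where
  "multiplicity k n i j =
     (rank k n (Suc i) j - rank k n i j) - (rank k n (Suc i) (Suc j) - rank k n i (Suc j))"

definition pairs :: "'k::field itself \<Rightarrow> nat \<Rightarrow> (nat \<times> nat \<times> nat) set" where
  "pairs k n = (SIGMA i:{..<N}. SIGMA j:{i<..N}. {..<nat (multiplicity k n i j)})"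

definition death :: "(nat \<Rightarrow> real) \<Rightarrow> nat \<Rightarrow> ereal" where
  "death \<phi> j = (if j < N then ereal (\<phi> j) else \<infinity>)"

definition endpoints :: "(nat \<Rightarrow> real) \<Rightarrow> nat \<times> nat \<times> nat \<Rightarrow> real \<times> ereal" where
  "endpoints \<phi> = (\<lambda>(i, j, l). (\<phi> i, death \<phi> j))"

lemma finite_pairs: "finite (pairs k n)"
  unfolding pairs_def by (intro finite_SigmaI) auto

text \<open>For \<open>j < N\<close> this is supermodularity of ranks. At \<open>j = N\<close> the
  terms with \<open>Suc j\<close> vanish by convention, and monotonicity in the first complex
  remains.\<close>

lemma multiplicity_nonneg:
  assumes "j \<le> N"
  shows "0 \<le> multiplicity TYPE('k::field) n i j"
proof (cases "Suc j \<le> N")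
  case True
  have "homology_rank TYPE('k) n (K i) (K j) + homology_rank TYPE('k) n (K (Suc i)) (K (Suc j))
      \<le> homology_rank TYPE('k) n (K (Suc i)) (K j) + homology_rank TYPE('k) n (K i) (K (Suc j))"
    by (intro homology_rank_supermodular finite_K K_mono) auto
  with assms True show ?thesis
    by (simp add: multiplicity_def rank_def)
next
  case False
  have "homology_rank TYPE('k) n (K i) (K j) \<le> homology_rank TYPE('k) n (K (Suc i)) (K j)"
    by (intro homology_rank_mono finite_K K_mono) auto
  with assms False show ?thesis
    by (simp add: multiplicity_def rank_def)
qed

text \<open>The sum telescopes in both directions, so a rectangle of index pairs is counted by four
  ranks, as in \<open>pair_count\<close>.\<close>

lemma sum_multiplicity:
  assumes "p' \<le> p" "q' \<le> q"
  shows "(\<Sum>i=p'..<p. \<Sum>j=q'..<q. multiplicity k n i j) =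
    (rank k n p q' - rank k n p' q') - (rank k n p q - rank k n p' q)"
proof -
  have "(\<Sum>j=q'..<q. multiplicity k n i j) =
      (rank k n (Suc i) q' - rank k n (Suc i) q) - (rank k n i q' - rank k n i q)" for i
    using sum_Suc_diff'[OF assms(2), of "\<lambda>j. rank k n i j - rank k n (Suc i) j"]
    by (simp add: multiplicity_def algebra_simps)
  then show ?thesis
    using sum_Suc_diff'[OF assms(1), of "\<lambda>i. rank k n i q' - rank k n i q"] by simp
qed

lemma endpoints_ordered:
  assumes "\<And>i j. i \<le> j \<Longrightarrow> j < N \<Longrightarrow> \<phi> i \<le> \<phi> j" and "x \<in> pairs k n"
  shows "ereal (fst (endpoints \<phi> x)) \<le> snd (endpoints \<phi> x)"
  using assms by (auto simp: endpoints_def death_def pairs_def)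

text \<open>Several steps may share a parameter value. Those with value \<open>b\<close> form the
  interval \<open>{p'..<p}\<close>, those with death \<open>d\<close> the interval
  \<open>{q'..<q}\<close>, and the multiplicities over this rectangle sum to the value of
  \<open>pair_count\<close> for small \<epsilon>.\<close>

theorem dgm_eq_push_diagram:
  fixes F :: "real \<Rightarrow> 'a set set"
  assumes \<phi>: "\<And>i j. i \<le> j \<Longrightarrow> j < N \<Longrightarrow> \<phi> i \<le> \<phi> j" "\<And>i. i < N \<Longrightarrow> 0 \<le> \<phi> i"
    and F: "\<And>s. F s = K (card {i. i < N \<and> \<phi> i \<le> s})"
  shows "dgm TYPE('k::field) n F = push_diagram (pairs TYPE('k) n) (endpoints \<phi>)"
proof (intro ext, clarify)
  fix b :: real and d :: ereal
  let ?r = "rank TYPE('k) n" and ?M = "multiplicity TYPE('k) n"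
  define c where "c s = card {i. i < N \<and> \<phi> i \<le> s}" for s
  define p p' where "p = c b" and "p' = card {i. i < N \<and> \<phi> i < b}"
  \<comment> \<open>Here the index \<open>N\<close>, with infinite death, is included, so
    \<open>q\<close> can reach \<open>Suc N\<close>.\<close>
  define q q' where "q = card {j. j \<le> N \<and> death \<phi> j \<le> d}"
    and "q' = card {j. j \<le> N \<and> death \<phi> j < d}"
  have c_le: "c s \<le> N" for s
    using card_mono[of "{..<N}" "{i. i < N \<and> \<phi> i \<le> s}"] by (auto simp: c_def)
  \<comment> \<open>The cutoff at negative parameters is consistent: no step has happened there, and
    \<open>K 0\<close> is empty.\<close>
  have betti: "persistent_betti TYPE('k) n F s t = ?r (c s) (c t)" for s t
  proof (cases "s < 0")
    case True
    then have "{i. i < N \<and> \<phi> i \<le> s} = {}"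
      using \<phi>(2) by force
    then have "c s = 0"
      by (simp only: c_def card.empty)
    with True show ?thesis
      by (simp add: persistent_betti_def rank_def K_0 homology_rank_empty)
  next
    case False
    then show ?thesis
      using c_le by (simp add: persistent_betti_def rank_def F c_def)
  qed
  have death_mono: "death \<phi> i \<le> death \<phi> j" if "i \<le> j" for i j
    using that \<phi>(1) by (auto simp: death_def)
  have p: "{i. i < N \<and> \<phi> i \<le> b} = {..<p}" "{i. i < N \<and> \<phi> i < b} = {..<p'}"
    unfolding p_def c_def p'_def
    by (rule down_closed_eq_lessThan_card; use \<phi>(1) in force)+
  have q: "{j. j \<le> N \<and> death \<phi> j \<le> d} = {..<q}" "{j. j \<le> N \<and> death \<phi> j < d} = {..<q'}"
    unfolding q_def q'_def
    by (rule down_closed_eq_lessThan_card; use death_mono in \<open>auto intro: order_trans le_less_trans\<close>)+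
  have le: "p' \<le> p" "q' \<le> q"
    unfolding p_def c_def p'_def q_def q'_def by (intro card_mono; force)+
  show "dgm TYPE('k) n F (b, d) = push_diagram (pairs TYPE('k) n) (endpoints \<phi>) (b, d)"
  proof (cases "ereal b < d")
    case bd: True
    have birth: "i \<in> {p'..<p} \<longleftrightarrow> i < N \<and> \<phi> i = b" for i
    proof -
      have "i \<in> {p'..<p} \<longleftrightarrow> i \<in> {..<p} \<and> i \<notin> {..<p'}"
        by auto
      then show ?thesis
        unfolding p[symmetric] by auto
    qed
    have dead: "j \<in> {q'..<q} \<longleftrightarrow> j \<le> N \<and> death \<phi> j = d" for j
    proof -
      have "j \<in> {q'..<q} \<longleftrightarrow> j \<in> {..<q} \<and> j \<notin> {..<q'}"
        by auto
      then show ?thesis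
        unfolding q[symmetric] by auto
    qed
    \<comment> \<open>A birth value strictly below the death value forces \<open>i < j\<close>, so
      the restriction to \<open>i < j\<close> in \<open>pairs\<close> loses nothing in the
      rectangle.\<close>
    have less: "i < j" if "i < N" "ereal (\<phi> i) < death \<phi> j" for i j
      using that \<phi>(1)[of j i] by (cases "i < j") (auto simp: death_def)
    have "{x \<in> pairs TYPE('k) n. endpoints \<phi> x = (b, d)}
        = (SIGMA i:{p'..<p}. SIGMA j:{q'..<q}. {..<nat (?M i j)})"
      using birth dead less bd unfolding pairs_def endpoints_def
      by (auto simp del: atLeastLessThan_iff)
    then have "push_diagram (pairs TYPE('k) n) (endpoints \<phi>) (b, d)
        = (\<Sum>i=p'..<p. \<Sum>j=q'..<q. nat (?M i j))"
      using bd by (simp add: push_diagram_def card_SigmaI)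
    also have "int \<dots> = (\<Sum>i=p'..<p. \<Sum>j=q'..<q. ?M i j)"
      unfolding of_nat_sum using dead by (intro sum.cong refl nat_0_le multiplicity_nonneg) blast
    also have "\<dots> = (?r p q' - ?r p' q') - (?r p q - ?r p' q)"
      using le by (rule sum_multiplicity)
    finally have count: "int (push_diagram (pairs TYPE('k) n) (endpoints \<phi>) (b, d))
        = (?r p q' - ?r p' q') - (?r p q - ?r p' q)" .
    have near: "\<forall>\<^sub>F \<epsilon> in at_right 0. \<forall>i\<in>{..<N}.
        (\<phi> i \<le> x + \<epsilon> \<longleftrightarrow> \<phi> i \<le> x) \<and> (\<phi> i \<le> x - \<epsilon> \<longleftrightarrow> \<phi> i < x) \<and> \<phi> i \<le> 1 / \<epsilon>" for x
      by (intro eventually_ball_finite ballI eventually_at_right_compare) auto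
    have "\<forall>\<^sub>F \<epsilon> in at_right 0. pair_count TYPE('k) n F b d \<epsilon>
        = int (push_diagram (pairs TYPE('k) n) (endpoints \<phi>) (b, d))"
    proof (cases d)
      case (real x)
      have "{j. j \<le> N \<and> death \<phi> j \<le> d} = {j. j < N \<and> \<phi> j \<le> x}"
        "{j. j \<le> N \<and> death \<phi> j < d} = {j. j < N \<and> \<phi> j < x}"
        by (auto simp: real death_def split: if_splits)
      then have "q = c x" "q' = card {j. j < N \<and> \<phi> j < x}"
        by (simp_all only: q_def q'_def c_def)
      moreover have "c (b + \<epsilon>) = p \<and> c (b - \<epsilon>) = p' \<and> c (x - \<epsilon>) = card {j. j < N \<and> \<phi> j < x}
          \<and> c (x + \<epsilon>) = c x"
        if "\<forall>i\<in>{..<N}. (\<phi> i \<le> b + \<epsilon> \<longleftrightarrow> \<phi> i \<le> b) \<and> (\<phi> i \<le> b - \<epsilon> \<longleftrightarrow> \<phi> i < b) \<and> \<phi> i \<le> 1 / \<epsilon>"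
          "\<forall>i\<in>{..<N}. (\<phi> i \<le> x + \<epsilon> \<longleftrightarrow> \<phi> i \<le> x) \<and> (\<phi> i \<le> x - \<epsilon> \<longleftrightarrow> \<phi> i < x) \<and> \<phi> i \<le> 1 / \<epsilon>" for \<epsilon>
        unfolding c_def p_def p'_def using that by (intro conjI arg_cong[of _ _ card]) auto
      ultimately show ?thesis
        unfolding count using eventually_conj[OF near[of b] near[of x]]
        by (elim eventually_mono) (auto simp: pair_count_def betti real)
    next
      case PInf
      \<comment> \<open>The ranks at \<open>q = Suc N\<close> are 0 by convention, which leaves the
        two-term form of \<open>pair_count\<close> for infinite death.\<close>
      have "{j. j \<le> N \<and> death \<phi> j \<le> d} = {..<Suc N}" "{j. j \<le> N \<and> death \<phi> j < d} = {..<N}"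
        by (auto simp: PInf death_def)
      then have "q = Suc N" "q' = N"
        by (simp_all only: q_def q'_def card_lessThan)
      moreover have "c (b + \<epsilon>) = p \<and> c (b - \<epsilon>) = p' \<and> c (1 / \<epsilon>) = card {..<N}"
        if "\<forall>i\<in>{..<N}. (\<phi> i \<le> b + \<epsilon> \<longleftrightarrow> \<phi> i \<le> b) \<and> (\<phi> i \<le> b - \<epsilon> \<longleftrightarrow> \<phi> i < b) \<and> \<phi> i \<le> 1 / \<epsilon>" for \<epsilon>
        unfolding c_def p_def p'_def using that by (intro conjI arg_cong[of _ _ card]) auto
      ultimately show ?thesis
        unfolding count using near[of b]
        by (elim eventually_mono) (simp add: pair_count_def betti PInf, simp add: rank_def)
    next
      case MInf
      then show ?thesis using bd by simp
    qed
    note ev = this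
    have "(THE m. \<forall>\<^sub>F \<epsilon> in at_right 0. pair_count TYPE('k) n F b d \<epsilon> = int m)
        = push_diagram (pairs TYPE('k) n) (endpoints \<phi>) (b, d)"
    proof (rule the_equality[where P = "\<lambda>m. \<forall>\<^sub>F \<epsilon> in at_right 0. pair_count TYPE('k) n F b d \<epsilon> = int m",
          OF ev])
      fix m assume "\<forall>\<^sub>F \<epsilon> in at_right 0. pair_count TYPE('k) n F b d \<epsilon> = int m"
      from eventually_conj[OF this ev] show "m = push_diagram (pairs TYPE('k) n) (endpoints \<phi>) (b, d)"
        using eventually_happens'[OF trivial_limit_at_right_real] by fastforce
    qed
    then show ?thesis
      using bd by (simp add: dgm_def)
  next
    case False
    then show ?thesis
      by (simp add: dgm_def push_diagram_def)
  qed
qed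

end

section \<open>Stability of sublevel filtrations\<close>

text \<open>The rank counts the distinct smaller values of \<open>g\<close>. Ties share a rank, and
  an injection of the values into as many natural numbers leaves no gaps.\<close>

lemma ex_ranking:
  fixes g :: "'b \<Rightarrow> real"
  assumes "finite D"
  obtains N and r :: "'b \<Rightarrow> nat" where "r ` D = {..<N}"
    and "\<And>\<sigma> \<tau>. \<sigma> \<in> D \<Longrightarrow> \<tau> \<in> D \<Longrightarrow> r \<sigma> \<le> r \<tau> \<longleftrightarrow> g \<sigma> \<le> g \<tau>"
proof -
  define r where "r c = card {c'\<in>g ` D. c' < c}" for c
  have less: "r c < r c'" if "c \<in> g ` D" "c < c'" for c c'
    unfolding r_def using assms that by (intro psubset_card_mono) auto
  then have le: "r c \<le> r c' \<longleftrightarrow> c \<le> c'" if "c \<in> g ` D" "c' \<in> g ` D" for c c'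
    using that by (metis linorder_not_less order_le_less)
  have "r c < card (g ` D)" if "c \<in> g ` D" for c
    unfolding r_def using assms that by (intro psubset_card_mono) auto
  moreover have "inj_on r (g ` D)"
    using le by (intro inj_onI order_antisym) (metis order_refl)+
  ultimately have "r ` g ` D = {..<card (g ` D)}"
    using assms by (intro card_subset_eq) (auto simp: card_image)
  then show thesis
    using that[of "r \<circ> g" "card (g ` D)"] le by (auto simp: image_comp)
qed

lemma finite_filtration_ranking:
  assumes "finite D"
  shows "finite_filtration (\<lambda>i. {\<sigma>\<in>D. r \<sigma> < i})"
  using assms by unfold_locales auto

text \<open>The ranking may be finer than the order by \<open>f\<close>. As \<open>f\<close> is
  constant on each rank, the representative chosen by \<open>inv_into\<close> gives the parameter of
  that step.\<close>

lemma dgm_sublevel: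
  fixes D :: "'a set set" and r :: "'a set \<Rightarrow> nat"
  assumes D: "finite D" "r ` D = {..<N}" and f: "\<And>\<sigma>. \<sigma> \<in> D \<Longrightarrow> 0 \<le> f \<sigma>"
    "\<And>\<sigma> \<tau>. \<sigma> \<in> D \<Longrightarrow> \<tau> \<in> D \<Longrightarrow> r \<sigma> \<le> r \<tau> \<Longrightarrow> f \<sigma> \<le> f \<tau>"
  shows "dgm TYPE('k::field) n (\<lambda>s. {\<sigma>\<in>D. f \<sigma> \<le> s})
    = push_diagram (finite_filtration.pairs (\<lambda>i. {\<sigma>\<in>D. r \<sigma> < i}) N TYPE('k) n)
        (finite_filtration.endpoints N (\<lambda>i. f (inv_into D r i)))"
proof -
  interpret finite_filtration "\<lambda>i. {\<sigma>\<in>D. r \<sigma> < i}" N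
    using D(1) by (rule finite_filtration_ranking)
  let ?\<phi> = "\<lambda>i. f (inv_into D r i)"
  have inv: "inv_into D r i \<in> D" "r (inv_into D r i) = i" if "i < N" for i
    using that D(2) inv_into_into[of i r D] f_inv_into_f[of i r D] by auto
  have \<phi>_mono: "?\<phi> i \<le> ?\<phi> j" if "i \<le> j" "j < N" for i j
    using that inv by (intro f(2)) auto
  have \<phi>_r: "?\<phi> (r \<sigma>) = f \<sigma>" if "\<sigma> \<in> D" for \<sigma>
  proof -
    have "r \<sigma> < N"
      using that D(2) by blast
    then show ?thesis
      using that inv[of "r \<sigma>"] by (intro order_antisym f(2)) auto
  qed
  show ?thesis
  proof (rule dgm_eq_push_diagram)
    show "{\<sigma>\<in>D. f \<sigma> \<le> s} = {\<sigma>\<in>D. r \<sigma> < card {i. i < N \<and> ?\<phi> i \<le> s}}" for s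
    proof -
      have "{i. i < N \<and> ?\<phi> i \<le> s} = {..<card {i. i < N \<and> ?\<phi> i \<le> s}}"
        by (rule down_closed_eq_lessThan_card) (use \<phi>_mono in \<open>auto intro: order_trans\<close>)
      then have "r \<sigma> < card {i. i < N \<and> ?\<phi> i \<le> s} \<longleftrightarrow> r \<sigma> < N \<and> ?\<phi> (r \<sigma>) \<le> s" for \<sigma>
        by blast
      then show ?thesis
        using D(2) \<phi>_r by auto
    qed
  qed (use \<phi>_mono inv f(1) in auto)
qed

text \<open>The ranking by \<open>g\<close> serves both functions, since by \<open>fg\<close>
  passing to \<open>f\<close> can only create ties. Both diagrams are thus images of the same index
  pairs.\<close>

lemma matched_dgm_same_order:
  fixes D :: "'a set set" and f g :: "'a set \<Rightarrow> real"
  assumes D: "finite D" and pos: "\<And>\<sigma>. \<sigma> \<in> D \<Longrightarrow> 0 \<le> f \<sigma>" "\<And>\<sigma>. \<sigma> \<in> D \<Longrightarrow> 0 \<le> g \<sigma>"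
    and fg: "\<And>\<sigma> \<tau>. \<sigma> \<in> D \<Longrightarrow> \<tau> \<in> D \<Longrightarrow> g \<sigma> \<le> g \<tau> \<Longrightarrow> f \<sigma> \<le> f \<tau>"
    and e: "\<And>\<sigma>. \<sigma> \<in> D \<Longrightarrow> \<bar>f \<sigma> - g \<sigma>\<bar> \<le> e" "0 \<le> e"
  shows "matched e (dgm TYPE('k::field) n (\<lambda>s. {\<sigma>\<in>D. f \<sigma> \<le> s})) (dgm TYPE('k) n (\<lambda>s. {\<sigma>\<in>D. g \<sigma> \<le> s}))"
proof -
  obtain N and r :: "'a set \<Rightarrow> nat" where r: "r ` D = {..<N}"
    "\<And>\<sigma> \<tau>. \<sigma> \<in> D \<Longrightarrow> \<tau> \<in> D \<Longrightarrow> r \<sigma> \<le> r \<tau> \<longleftrightarrow> g \<sigma> \<le> g \<tau>"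
    by (rule ex_ranking[OF D, of g]) (rule that)
  interpret finite_filtration "\<lambda>i. {\<sigma>\<in>D. r \<sigma> < i}" N
    using D by (rule finite_filtration_ranking)
  let ?\<sigma> = "inv_into D r"
  have inv: "?\<sigma> i \<in> D" "r (?\<sigma> i) = i" if "i < N" for i
    using that r(1) inv_into_into[of i r D] f_inv_into_f[of i r D] by auto
  have mono: "f (?\<sigma> i) \<le> f (?\<sigma> j)" "g (?\<sigma> i) \<le> g (?\<sigma> j)" if "i \<le> j" "j < N" for i j
    using that inv r(2)[of "?\<sigma> i" "?\<sigma> j"] fg[of "?\<sigma> i" "?\<sigma> j"] by auto
  have "matched e (push_diagram (pairs TYPE('k) n) (endpoints (\<lambda>i. f (?\<sigma> i))))
      (push_diagram (pairs TYPE('k) n) (endpoints (\<lambda>i. g (?\<sigma> i))))"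
  proof (rule matched_push_diagram)
    fix q assume q: "q \<in> pairs TYPE('k) n"
    show "ereal (fst (endpoints (\<lambda>i. f (?\<sigma> i)) q)) \<le> snd (endpoints (\<lambda>i. f (?\<sigma> i)) q)"
      using q mono by (intro endpoints_ordered) auto
    show "ereal (fst (endpoints (\<lambda>i. g (?\<sigma> i)) q)) \<le> snd (endpoints (\<lambda>i. g (?\<sigma> i)) q)"
      using q mono by (intro endpoints_ordered) auto
    show "point_dist (endpoints (\<lambda>i. f (?\<sigma> i)) q) (endpoints (\<lambda>i. g (?\<sigma> i)) q) \<le> ereal e"
      using q inv(1) e by (auto simp: point_dist_le_iff endpoints_def death_def pairs_def)
  qed (use e(2) finite_pairs in auto)
  moreover have "dgm TYPE('k) n (\<lambda>s. {\<sigma>\<in>D. f \<sigma> \<le> s})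
      = push_diagram (pairs TYPE('k) n) (endpoints (\<lambda>i. f (?\<sigma> i)))"
    using D r pos fg by (intro dgm_sublevel) auto
  moreover have "dgm TYPE('k) n (\<lambda>s. {\<sigma>\<in>D. g \<sigma> \<le> s})
      = push_diagram (pairs TYPE('k) n) (endpoints (\<lambda>i. g (?\<sigma> i)))"
    using D r pos by (intro dgm_sublevel) auto
  ultimately show ?thesis
    by simp
qed

theorem matched_dgm_sublevel:
  fixes D :: "'a set set" and f g :: "'a set \<Rightarrow> real"
  assumes D: "finite D" and pos: "\<And>\<sigma>. \<sigma> \<in> D \<Longrightarrow> 0 \<le> f \<sigma>" "\<And>\<sigma>. \<sigma> \<in> D \<Longrightarrow> 0 \<le> g \<sigma>"
    and e: "\<And>\<sigma>. \<sigma> \<in> D \<Longrightarrow> \<bar>f \<sigma> - g \<sigma>\<bar> \<le> e" "0 \<le> e"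
  shows "matched e (dgm TYPE('k::field) n (\<lambda>s. {\<sigma>\<in>D. f \<sigma> \<le> s})) (dgm TYPE('k) n (\<lambda>s. {\<sigma>\<in>D. g \<sigma> \<le> s}))"
proof -
  define h where "h t \<sigma> = (1 - t) * f \<sigma> + t * g \<sigma>" for t \<sigma>
  define m where "m t = dgm TYPE('k) n (\<lambda>s. {\<sigma>\<in>D. h t \<sigma> \<le> s})" for t
  have h_pos: "0 \<le> h t \<sigma>" if "\<sigma> \<in> D" "0 \<le> t" "t \<le> 1" for t \<sigma>
    using that pos by (simp add: h_def)
  have h_diff: "\<bar>h s \<sigma> - h t \<sigma>\<bar> \<le> \<bar>s - t\<bar> * e" if "\<sigma> \<in> D" for s t \<sigma>
  proof -
    have "\<bar>h s \<sigma> - h t \<sigma>\<bar> = \<bar>(t - s) * (f \<sigma> - g \<sigma>)\<bar>"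
      by (simp add: h_def algebra_simps)
    also have "\<dots> \<le> \<bar>s - t\<bar> * e"
      using e(1)[OF that] by (simp add: abs_mult abs_minus_commute mult_left_mono)
    finally show ?thesis .
  qed
  have local: "\<exists>d>0. \<forall>t. \<bar>t - x\<bar> < d \<and> 0 \<le> t \<and> t \<le> 1 \<longrightarrow> matched (\<bar>t - x\<bar> * e) (m x) (m t)"
    if x: "0 \<le> x" "x \<le> 1" for x
  proof -
    \<comment> \<open>By continuity a strict inequality at \<open>x\<close> persists nearby;
      finitely many pairs then share one neighbourhood.\<close>
    have "\<forall>\<^sub>F t in nhds x. h t (fst p) \<le> h t (snd p) \<longrightarrow> h x (fst p) \<le> h x (snd p)" for p
    proof (cases "h x (fst p) \<le> h x (snd p)")
      case False
      have "((\<lambda>t. h t (fst p) - h t (snd p)) \<longlongrightarrow> h x (fst p) - h x (snd p)) (nhds x)"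
        unfolding h_def by (intro tendsto_intros filterlim_ident)
      then have "\<forall>\<^sub>F t in nhds x. 0 < h t (fst p) - h t (snd p)"
        by (rule order_tendstoD) (use False in simp)
      then show ?thesis
        by (rule eventually_mono) simp
    qed simp
    then have "\<forall>\<^sub>F t in nhds x. \<forall>p\<in>D \<times> D. h t (fst p) \<le> h t (snd p) \<longrightarrow> h x (fst p) \<le> h x (snd p)"
      using D by (intro eventually_ball_finite) auto
    then obtain d where d: "d > 0" "\<And>t. \<bar>t - x\<bar> < d \<Longrightarrow>
        \<forall>p\<in>D \<times> D. h t (fst p) \<le> h t (snd p) \<longrightarrow> h x (fst p) \<le> h x (snd p)"
      unfolding eventually_nhds_metric dist_real_def by blast
    have "matched (\<bar>t - x\<bar> * e) (m x) (m t)" if t: "\<bar>t - x\<bar> < d" "0 \<le> t" "t \<le> 1" for t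
      unfolding m_def
    proof (rule matched_dgm_same_order)
      show "\<bar>h x \<sigma> - h t \<sigma>\<bar> \<le> \<bar>t - x\<bar> * e" if "\<sigma> \<in> D" for \<sigma>
        using h_diff[OF that, of x t] by (simp add: abs_minus_commute)
    qed (use D d(2)[OF t(1)] t x h_pos e(2) in auto)
    with d(1) show ?thesis
      by blast
  qed
  have "0 \<le> (0::real) \<longrightarrow> (1::real) \<le> 1 \<longrightarrow> matched ((1 - 0) * e) (m 0) (m 1)"
  \<comment> \<open>Bisection: a property of intervals that is additive and holds on short intervals
    around each point holds on the whole. The guards keep parameters in the unit interval, where
    \<open>h\<close> is nonnegative.\<close>
  proof (rule Bolzano[where P = "\<lambda>a b. 0 \<le> a \<longrightarrow> b \<le> 1 \<longrightarrow> matched ((b - a) * e) (m a) (m b)"])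
    fix a b c :: real
    assume "0 \<le> a \<longrightarrow> b \<le> 1 \<longrightarrow> matched ((b - a) * e) (m a) (m b)"
      "0 \<le> b \<longrightarrow> c \<le> 1 \<longrightarrow> matched ((c - b) * e) (m b) (m c)" "a \<le> b" "b \<le> c"
    then show "0 \<le> a \<longrightarrow> c \<le> 1 \<longrightarrow> matched ((c - a) * e) (m a) (m c)"
      using matched_trans[of "(b - a) * e" "m a" "m b" "(c - b) * e" "m c"] by (auto simp: algebra_simps)
  next
    fix x :: real assume "0 \<le> x" "x \<le> 1"
    then obtain d where d: "d > 0"
      "\<And>t. \<bar>t - x\<bar> < d \<Longrightarrow> 0 \<le> t \<Longrightarrow> t \<le> 1 \<Longrightarrow> matched (\<bar>t - x\<bar> * e) (m x) (m t)"
      using local by blast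
    have "matched ((b - a) * e) (m a) (m b)"
      if "a \<le> x" "x \<le> b" "b - a < d" "0 \<le> a" "b \<le> 1" for a b
    proof -
      \<comment> \<open>The path goes through \<open>x\<close>, because \<open>local\<close>
        compares only with the order at \<open>x\<close>; the two lengths add up exactly.\<close>
      have "matched ((x - a) * e) (m a) (m x)"
        using d(2)[of a] that matched_sym by auto
      moreover have "matched ((b - x) * e) (m x) (m b)"
        using d(2)[of b] that by auto
      ultimately have "matched ((x - a) * e + (b - x) * e) (m a) (m b)"
        by (rule matched_trans)
      then show ?thesis
        by (simp add: algebra_simps)
    qed
    with d(1) show "\<exists>d>0. \<forall>a b. a \<le> x \<and> x \<le> b \<and> b - a < d \<longrightarrow>
        0 \<le> a \<longrightarrow> b \<le> 1 \<longrightarrow> matched ((b - a) * e) (m a) (m b)"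
      by blast
  qed simp
  then show ?thesis
    by (simp add: m_def h_def)
qed

section \<open>Flood complexes\<close>

lemma mem_thickening_iff:
  fixes X :: "'a::heine_borel set"
  assumes "finite X" "X \<noteq> {}"
  shows "x \<in> thickening X r \<longleftrightarrow> infdist x X \<le> r"
proof
  assume "x \<in> thickening X r"
  then show "infdist x X \<le> r"
    by (auto simp: thickening_def dist_commute intro: infdist_le2)
next
  assume "infdist x X \<le> r"
  moreover obtain y where "y \<in> X" "infdist x X = dist x y"
    using infdist_attains_inf[OF finite_imp_closed[OF assms(1)] assms(2)] by blast
  ultimately show "x \<in> thickening X r"
    by (auto simp: thickening_def dist_commute)
qed

lemma bdd_above_infdist:
  fixes A :: "'a::metric_space set"
  assumes "compact A"
  shows "bdd_above ((\<lambda>x. infdist x X) ` A)"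
  using assms by (intro bounded_imp_bdd_above compact_imp_bounded compact_continuous_image continuous_intros)

text \<open>Identifies the parameter at which a set is flooded, which turns both complexes into
  sublevel filtrations.\<close>

lemma subset_thickening_iff:
  fixes A :: "'a::heine_borel set"
  assumes "finite X" "X \<noteq> {}" "compact A" "A \<noteq> {}"
  shows "A \<subseteq> thickening X r \<longleftrightarrow> (SUP x\<in>A. infdist x X) \<le> r"
  using assms by (auto simp: mem_thickening_iff subset_iff cSUP_le_iff[OF _ bdd_above_infdist])

text \<open>The distance to \<open>X\<close> is 1-Lipschitz, and every point of \<open>B\<close> has
  a nearest point of \<open>A\<close> within the Hausdorff distance.\<close>

lemma SUP_infdist_le_hausdorff:
  fixes A B X :: "'a::heine_borel set"
  assumes "compact A" "A \<noteq> {}" "compact B" "B \<noteq> {}"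
  shows "(SUP x\<in>B. infdist x X) \<le> (SUP x\<in>A. infdist x X) + hausdorff_dist A B"
proof (rule cSUP_least)
  fix x assume x: "x \<in> B"
  obtain p where p: "p \<in> A" "infdist x A = dist x p"
    using infdist_attains_inf[OF compact_imp_closed[OF assms(1)] assms(2)] by blast
  have "infdist x X \<le> infdist p X + dist x p"
    by (rule infdist_triangle)
  also have "infdist p X \<le> (SUP x\<in>A. infdist x X)"
    using p bdd_above_infdist[OF assms(1)] by (intro cSUP_upper)
  also have "dist x p \<le> (SUP x\<in>B. infdist x A)"
    using x p(2) bdd_above_infdist[OF assms(3), of A] by (metis cSUP_upper)
  also have "\<dots> \<le> hausdorff_dist A B"
    by (simp add: hausdorff_dist_def)
  finally show "infdist x X \<le> (SUP x\<in>A. infdist x X) + hausdorff_dist A B"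
    by simp
qed (fact assms)

theorem theorem5:
  fixes X L :: "'a::euclidean_space set"
    and D :: "'a set set"
    and P :: "'a set \<Rightarrow> 'a set"
    and i :: nat
  assumes "finite X" and "X \<noteq> {}"
    and "finite L" and "L \<noteq> {}"
    and "delaunay_triangulation L D"
    and "\<And>\<sigma>. \<sigma> \<in> D \<Longrightarrow> finite (P \<sigma>)"
    and "\<And>\<sigma>. \<sigma> \<in> D \<Longrightarrow> P \<sigma> \<noteq> {}"
    and "\<And>\<sigma>. \<sigma> \<in> D \<Longrightarrow> P \<sigma> \<subseteq> convex hull \<sigma>"
  shows "bottleneck_dist (dgm TYPE('k::field) i (flood X D))
           (dgm TYPE('k) i (flood_discrete X D P))
         \<le> ereal (MAX \<sigma>\<in>D. hausdorff_dist (P \<sigma>) (convex hull \<sigma>))"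
proof -
  let ?H = "\<lambda>A. SUP x\<in>A. infdist x X"
  \<comment> \<open>Collecting the samples of all faces makes the discrete condition a single
    inclusion.\<close>
  define Q where "Q \<sigma> = (\<Union>\<tau>\<in>{\<tau>. \<tau> \<subseteq> \<sigma> \<and> \<tau> \<noteq> {}}. P \<tau>)" for \<sigma>
  define e where "e = (MAX \<sigma>\<in>D. hausdorff_dist (P \<sigma>) (convex hull \<sigma>))"
  have "\<Union>D = L" and complex: "abstract_complex D"
    using assms(5) by (auto simp: delaunay_triangulation_def)
  then have D: "finite D" "D \<noteq> {}"
    using assms(3,4) finite_UnionD by auto
  have \<sigma>: "finite \<sigma>" "\<sigma> \<noteq> {}" "\<And>\<tau>. \<tau> \<subseteq> \<sigma> \<Longrightarrow> \<tau> \<noteq> {} \<Longrightarrow> \<tau> \<in> D" if "\<sigma> \<in> D" for \<sigma>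
    using complex that unfolding abstract_complex_def by blast+
  have hull: "compact (convex hull \<sigma>)" "convex hull \<sigma> \<noteq> {}" if "\<sigma> \<in> D" for \<sigma>
    using \<sigma>[OF that] by (auto intro: finite_imp_compact_convex_hull)
  have P: "compact (P \<sigma>)" "P \<sigma> \<noteq> {}" if "\<sigma> \<in> D" for \<sigma>
    using assms(6,7) that by (auto intro: finite_imp_compact)
  have Q: "compact (Q \<sigma>)" "Q \<sigma> \<noteq> {}" "P \<sigma> \<subseteq> Q \<sigma>" "Q \<sigma> \<subseteq> convex hull \<sigma>" if "\<sigma> \<in> D" for \<sigma>
  proof -
    have "finite {\<tau>. \<tau> \<subseteq> \<sigma> \<and> \<tau> \<noteq> {}}"
      using \<sigma>(1)[OF that] by (auto intro: finite_subset[of _ "Pow \<sigma>"])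
    then have "finite (Q \<sigma>)"
      unfolding Q_def using \<sigma>(3)[OF that] assms(6) by blast
    then show "compact (Q \<sigma>)"
      by (rule finite_imp_compact)
    show PQ: "P \<sigma> \<subseteq> Q \<sigma>"
      unfolding Q_def using \<sigma>(2)[OF that] by blast
    then show "Q \<sigma> \<noteq> {}"
      using assms(7)[OF that] by blast
    show "Q \<sigma> \<subseteq> convex hull \<sigma>"
      unfolding Q_def
    proof (intro UN_least, clarify)
      fix \<tau> x assume \<tau>: "\<tau> \<subseteq> \<sigma>" "\<tau> \<noteq> {}" "x \<in> P \<tau>"
      then have "x \<in> convex hull \<tau>"
        using assms(8)[OF \<sigma>(3)[OF that]] by blast
      then show "x \<in> convex hull \<sigma>"
        using hull_mono[OF \<tau>(1), of convex] by blast
    qed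
  qed
  have flood: "flood X D = (\<lambda>r. {\<sigma>\<in>D. ?H (convex hull \<sigma>) \<le> r})"
    unfolding flood_def by (intro ext Collect_cong conj_cong refl subset_thickening_iff assms(1,2) hull)
  have "(\<forall>\<tau>. \<tau> \<subseteq> \<sigma> \<and> \<tau> \<noteq> {} \<longrightarrow> P \<tau> \<subseteq> thickening X r) \<longleftrightarrow> Q \<sigma> \<subseteq> thickening X r" for \<sigma> r
    unfolding Q_def by blast
  then have discrete: "flood_discrete X D P = (\<lambda>r. {\<sigma>\<in>D. ?H (Q \<sigma>) \<le> r})"
    unfolding flood_discrete_def
    by (simp only:) (intro ext Collect_cong conj_cong refl subset_thickening_iff assms(1,2) Q)
  have H_nonneg: "0 \<le> ?H A" if "compact A" "A \<noteq> {}" for A :: "'a set"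
    using that bdd_above_infdist[of A X] infdist_nonneg by (metis all_not_in_conv cSUP_upper2)
  have H_mono: "?H A \<le> ?H B" if "A \<subseteq> B" "A \<noteq> {}" "compact B" for A B :: "'a set"
    using that by (intro cSUP_subset_mono bdd_above_infdist) auto
  have le_e: "hausdorff_dist (P \<sigma>) (convex hull \<sigma>) \<le> e" if "\<sigma> \<in> D" for \<sigma>
    unfolding e_def using that D by (intro Max_ge) auto
  have diff: "\<bar>?H (convex hull \<sigma>) - ?H (Q \<sigma>)\<bar> \<le> e" if "\<sigma> \<in> D" for \<sigma>
  proof -
    \<comment> \<open>Since \<open>Q \<sigma>\<close> lies between \<open>P \<sigma>\<close> and the
      hull, the Hausdorff distance at \<sigma> itself bounds the difference; its proper faces add no
      error.\<close>
    have "?H (Q \<sigma>) \<le> ?H (convex hull \<sigma>)" "?H (P \<sigma>) \<le> ?H (Q \<sigma>)"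
      by (intro H_mono P(2) Q hull that)+
    moreover have "?H (convex hull \<sigma>) \<le> ?H (P \<sigma>) + hausdorff_dist (P \<sigma>) (convex hull \<sigma>)"
      by (intro SUP_infdist_le_hausdorff P hull that)
    ultimately show ?thesis
      using le_e[OF that] by linarith
  qed
  have "0 \<le> e"
    using D(2) diff by (meson abs_ge_zero all_not_in_conv order_trans)
  then have "matched e (dgm TYPE('k) i (flood X D)) (dgm TYPE('k) i (flood_discrete X D P))"
    unfolding flood discrete by (intro matched_dgm_sublevel D(1) H_nonneg hull Q diff)
  then show ?thesis
    unfolding e_def by (rule bottleneck_dist_le)
qed

end
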